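(* Assume that $\bar x^*\in X^*$, $\bar x\in\widetilde B(\bar x^* )\setminus\{0\}$, and $X_+$ is SNC at $\bar x$. Then the set-valued map $\widetilde B: X^*\rightrightarrows X$ is Lipschitz-like at $(\bar x^*,\bar x)\in\mathrm{gph}\,\widetilde B$. Consequently, if $\bar p\in Y_+$, $\bar x\in B(\bar p)\setminus\{0\}$, and $X_+$ is SNC at $\bar x$, then the budget map $B$ is Lipschitz-like at $(\bar p,\bar x)$ in the sense that there exist a neighborhood $U$ of $\bar p$, a neighborhood $V$ of $\bar x$, and a constant $\ell>0$ satisfying $$B(p)\cap V\subset B(p')+\ell\|p-p'\|\,\overline{B}_X\qquad\text{for all } p,p'\in U\cap Y_+.$$
   Context: $X$ is a real reflexive Banach space with dual $X^*$, and $X_+\subset X$ is a nonempty closed convex cone. The set of prices is $Y_+=\{p\in X^*: \langle p,x\rangle\ge 0\ \forall x\in X_+\}$. The budget map is $B(p)=\{x\in X_+:\langle p,x\rangle\le 1\}$ for $p\in Y_+$ and $B(p)=\emptyset$ for $p\in X^*\setminus Y_+$. The map $\widetilde B:X^*\rightrightarrows X$ is defined for all $x^*\in X^*$ by $\widetilde B(x^* )=\{x\in X: 0\in f(x^*,x)+Q(x^*,x)\}$ with $f(x^*,x)=(\langle x^*,x\rangle-1,-x)\in\mathbb R\times X$ and $Q(x^*,x)=\mathbb R_+\times X_+$, that is, $\widetilde B(x^* )=\{x\in X_+:\langle x^*,x\rangle\le 1\}$. $\overline B_X$ denotes the closed unit ball of $X$. A set-valued map $F:Z\rightrightarrows W$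 between Banach spaces, with graph $\mathrm{gph}\,F=\{(z,w):w\in F(z)\}$, is Lipschitz-like at $(\bar z,\bar w)\in\mathrm{gph}\,F$ if there are a constant $l>0$ and neighborhoods $U$ of $\bar z$, $V$ of $\bar w$ such that $F(z)\cap V\subset F(z')+l\|z-z'\|\overline B_W$ for all $z,z'\in U$. For a subset $\Omega$ of a Banach space $Z$, $x\in\Omega$ and $\varepsilon\ge 0$, let $\widehat N_\varepsilon(x;\Omega)=\{x^*\in Z^*:\limsup_{u\to x,\,u\in\Omega}\frac{\langle x^*,u-x\rangle}{\|u-x\|}\le\varepsilon\}$. $\Omega$ is sequentially normally compact (SNC) at $\bar x\in\Omega$ if for all sequences $\varepsilon_k\downarrow 0$, $x_k\to\bar x$ with $x_k\in\Omega$, and $x_k^*\in\widehat N_{\varepsilon_k}(x_k;\Omega)$ converging weakly* to $0$, one has $\|x_k^*\|\to 0$. *)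

theory Defs
  imports "HOL-Analysis.Analysis"
begin

text \<open>The dual of \<open>'a\<close> is the Banach space \<open>'a \<Rightarrow>\<^sub>L real\<close> with the operator norm.\<close>

definition canonical_embedding :: "'a::real_normed_vector \<Rightarrow> ('a \<Rightarrow>\<^sub>L real) \<Rightarrow>\<^sub>L real"
  where "canonical_embedding x = Blinfun (\<lambda>f. blinfun_apply f x)"

lemma canonical_embedding_apply:
  "blinfun_apply (canonical_embedding x) f = blinfun_apply f x"
  unfolding canonical_embedding_def
  by (simp add: bounded_linear_Blinfun_apply blinfun.bounded_linear_left)

definition reflexive_space :: "'a::real_normed_vector itself \<Rightarrow> bool"
  where "reflexive_space _ \<longleftrightarrow>
    surj (canonical_embedding :: 'a \<Rightarrow> ('a \<Rightarrow>\<^sub>L real) \<Rightarrow>\<^sub>L real)"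

definition weak_star_tendsto ::
    "(nat \<Rightarrow> 'a::real_normed_vector \<Rightarrow>\<^sub>L real) \<Rightarrow> ('a \<Rightarrow>\<^sub>L real) \<Rightarrow> bool"
  where "weak_star_tendsto f g \<longleftrightarrow>
    (\<forall>x. (\<lambda>k. blinfun_apply (f k) x) \<longlonglongrightarrow> blinfun_apply g x)"

text \<open>The filter \<open>at x within \<Omega>\<close> leaves out the point \<open>u = x\<close>, where the quotient is
  undefined. The upper limit is taken in the extended reals, so it may be infinite. At an
  isolated point of \<open>\<Omega>\<close> it is \<open>-\<infinity>\<close>, and every functional is a normal there.\<close>

definition eps_normals ::
    "real \<Rightarrow> 'a::real_normed_vector \<Rightarrow> 'a set \<Rightarrow> ('a \<Rightarrow>\<^sub>L real) set"
  where "eps_normals \<epsilon> x \<Omega> =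
    {f. Limsup (at x within \<Omega>) (\<lambda>u. ereal (blinfun_apply f (u - x) / norm (u - x))) \<le> ereal \<epsilon>}"

text \<open>\<open>\<epsilon>\<^sub>k \<down> 0\<close> is read as nonincreasing convergence to 0, which forces \<open>\<epsilon>\<^sub>k \<ge> 0\<close>.
  As the sets of normals grow with \<open>\<epsilon>\<close>, omitting monotonicity, or asking for \<open>\<epsilon>\<^sub>k > 0\<close>,
  gives the same notion.\<close>

definition SNC_at :: "'a::real_normed_vector set \<Rightarrow> 'a \<Rightarrow> bool"
  where "SNC_at \<Omega> x0 \<longleftrightarrow> x0 \<in> \<Omega> \<and>
    (\<forall>\<epsilon> x f.
      decseq \<epsilon> \<and> \<epsilon> \<longlonglongrightarrow> 0 \<and>
      (\<forall>k. x k \<in> \<Omega>) \<and> x \<longlonglongrightarrow> x0 \<and>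
      (\<forall>k. f k \<in> eps_normals (\<epsilon> k) (x k) \<Omega>) \<and> weak_star_tendsto f 0
      \<longrightarrow> (\<lambda>k. norm (f k)) \<longlonglongrightarrow> 0)"

definition gph :: "('z \<Rightarrow> 'w set) \<Rightarrow> ('z \<times> 'w) set"
  where "gph F = {(z, w). w \<in> F z}"

text \<open>The sum of sets below is the Minkowski sum of \<^theory>\<open>HOL-Library.Set_Algebras\<close>.\<close>

definition lipschitz_like_at ::
    "('z::real_normed_vector \<Rightarrow> 'w::real_normed_vector set) \<Rightarrow> 'z \<times> 'w \<Rightarrow> bool"
  where "lipschitz_like_at F zw \<longleftrightarrow> zw \<in> gph F \<and>
    (\<exists>l>0. \<exists>U V. open U \<and> fst zw \<in> U \<and> open V \<and> snd zw \<in> V \<and>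
      (\<forall>z\<in>U. \<forall>z'\<in>U. F z \<inter> V \<subseteq> F z' + (\<lambda>b. (l * norm (z - z')) *\<^sub>R b) ` cball 0 1))"

definition prices :: "'a::real_normed_vector set \<Rightarrow> ('a \<Rightarrow>\<^sub>L real) set"
  where "prices Xp = {p. \<forall>x\<in>Xp. blinfun_apply p x \<ge> 0}"

definition budget :: "'a::real_normed_vector set \<Rightarrow> ('a \<Rightarrow>\<^sub>L real) \<Rightarrow> 'a set"
  where "budget Xp p =
    (if p \<in> prices Xp then {x \<in> Xp. blinfun_apply p x \<le> 1} else {})"

definition constraint_fun :: "('a::real_normed_vector \<Rightarrow>\<^sub>L real) \<Rightarrow> 'a \<Rightarrow> real \<times> 'a"
  where "constraint_fun p x = (blinfun_apply p x - 1, - x)"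

definition constraint_set ::
    "'a::real_normed_vector set \<Rightarrow> ('a \<Rightarrow>\<^sub>L real) \<Rightarrow> 'a \<Rightarrow> (real \<times> 'a) set"
  where "constraint_set Xp p x = {0..} \<times> Xp"

definition ext_budget :: "'a::real_normed_vector set \<Rightarrow> ('a \<Rightarrow>\<^sub>L real) \<Rightarrow> 'a set"
  where "ext_budget Xp p = {x. 0 \<in> {constraint_fun p x} + constraint_set Xp p x}"

lemma ext_budget_eq: "ext_budget Xp p = {x \<in> Xp. blinfun_apply p x \<le> 1}"
proof -
  have "0 \<in> {constraint_fun p x} + constraint_set Xp p x
      \<longleftrightarrow> x \<in> Xp \<and> blinfun_apply p x \<le> 1" for x
  proof
    assume "0 \<in> {constraint_fun p x} + constraint_set Xp p x"
    then obtain r y where "r \<ge> 0" "y \<in> Xp" and "(0, 0) = (blinfun_apply p x - 1 + r, - x + y)"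
      by (auto simp: set_plus_def constraint_fun_def constraint_set_def zero_prod_def)
    then show "x \<in> Xp \<and> blinfun_apply p x \<le> 1"
      by (auto simp: add_eq_0_iff)
  next
    assume "x \<in> Xp \<and> blinfun_apply p x \<le> 1"
    then have "(1 - blinfun_apply p x, x) \<in> constraint_set Xp p x"
      by (simp add: constraint_set_def)
    moreover have "0 = constraint_fun p x + (1 - blinfun_apply p x, x)"
      by (simp add: constraint_fun_def zero_prod_def)
    ultimately show "0 \<in> {constraint_fun p x} + constraint_set Xp p x"
      by (auto simp: set_plus_def)
  qed
  then show ?thesis
    by (simp add: ext_budget_def)
qed

end

theory Submission
  imports Defs
begin

text \<open>
  The budget set is a slice of a cone, so a violated budget constraint can be repaired by
  shrinking the bundle towards the origin, without leaving the cone. If \<open>p x \<le> 1\<close>, then a change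
  of the price from \<open>p\<close> to \<open>p'\<close> raises the cost of \<open>x\<close> to at most \<open>1 + \<parallel>p - p'\<parallel> \<parallel>x\<parallel>\<close>.
  Dividing \<open>x\<close> by this number restores feasibility and moves \<open>x\<close> by at most \<open>\<parallel>p - p'\<parallel> \<parallel>x\<parallel>\<^sup>2\<close>.
  Hence the extended budget map is Lipschitz in the price on every bounded set of bundles, with
  the squared radius as constant (lemma \<open>ext_budget_lipschitz_on_bounded\<close>). A unit ball around
  the reference bundle then serves as \<open>V\<close>, and every price is allowed in \<open>U\<close>. The budget map
  agrees with the extended one on the set of prices, so it inherits the same estimate there.
\<close>

lemma mem_scaled_unit_cball:
  fixes v :: "'a::real_normed_vector"
  assumes "norm v \<le> c"
  shows "v \<in> (\<lambda>b. c *\<^sub>R b) ` cball 0 1"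
proof (cases "c = 0")
  case True
  then show ?thesis
    using assms by (auto intro!: image_eqI[where x = 0])
next
  case False
  then have "c > 0"
    using assms norm_ge_zero[of v] by linarith
  then show ?thesis
    using assms by (intro image_eqI[where x = "v /\<^sub>R c"]) (auto simp: field_simps)
qed

text \<open>The factor \<open>t\<close> is the reciprocal of an upper bound \<open>1 + d \<ge> 1\<close> for the cost of \<open>x\<close> under
  \<open>p'\<close>. Bounding with \<open>1 + d\<close> rather than scaling by the cost itself keeps \<open>t\<close> in \<open>(0, 1]\<close> also
  when \<open>p' x\<close> is negative or zero.\<close>

lemma ext_budget_rescale:
  fixes Xp :: "'a::real_normed_vector set"
  assumes "conic Xp" and x: "x \<in> ext_budget Xp p"
  obtains y where "y \<in> ext_budget Xp p'" and "norm (x - y) \<le> (norm x)\<^sup>2 * norm (p - p')"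
proof -
  define d where "d = norm (p - p') * norm x"
  define t where "t = 1 / (1 + d)"
  have d: "d \<ge> 0"
    by (simp add: d_def)
  then have t: "t \<ge> 0" "t \<le> 1" "t * (1 + d) = 1"
    by (auto simp: t_def)
  have "blinfun_apply p' x = blinfun_apply p x - blinfun_apply (p - p') x"
    by (simp add: blinfun.diff_left)
  also have "\<dots> \<le> 1 + d"
    using x norm_blinfun[of "p - p'" x] by (auto simp: ext_budget_eq d_def)
  finally have "t * blinfun_apply p' x \<le> 1"
    using t mult_left_mono by metis
  moreover have "t *\<^sub>R x \<in> Xp"
    using assms t by (auto simp: ext_budget_eq conic_def)
  ultimately have "t *\<^sub>R x \<in> ext_budget Xp p'"
    by (simp add: ext_budget_eq blinfun.scaleR_right)
  moreover have "norm (x - t *\<^sub>R x) \<le> (norm x)\<^sup>2 * norm (p - p')"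
  proof -
    have "norm (x - t *\<^sub>R x) = norm ((1 - t) *\<^sub>R x)"
      by (simp add: algebra_simps)
    also have "\<dots> = (1 - t) * norm x"
      using t by simp
    also have "\<dots> = t * d * norm x"
    proof -
      have "1 - t = t * d"
        using t(3) by (simp add: algebra_simps)
      then show ?thesis
        by simp
    qed
    also have "\<dots> \<le> d * norm x"
      using t d by (simp add: mult_left_le_one_le mult_right_mono)
    finally show ?thesis
      by (simp add: d_def power2_eq_square algebra_simps)
  qed
  ultimately show thesis
    using that by blast
qed

lemma ext_budget_lipschitz_on_bounded:
  fixes Xp :: "'a::real_normed_vector set"
  assumes "conic Xp" and x: "x \<in> ext_budget Xp p" and r: "norm x \<le> r"
  shows "x \<in> ext_budget Xp p' + (\<lambda>b. (r\<^sup>2 * norm (p - p')) *\<^sub>R b) ` cball 0 1"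
proof -
  obtain y where y: "y \<in> ext_budget Xp p'" "norm (x - y) \<le> (norm x)\<^sup>2 * norm (p - p')"
    using ext_budget_rescale assms by metis
  have "(norm x)\<^sup>2 * norm (p - p') \<le> r\<^sup>2 * norm (p - p')"
    using r by (intro mult_right_mono power_mono) auto
  then have "x - y \<in> (\<lambda>b. (r\<^sup>2 * norm (p - p')) *\<^sub>R b) ` cball 0 1"
    using y by (intro mem_scaled_unit_cball) linarith
  from set_plus_intro[OF y(1) this] show ?thesis
    by simp
qed

lemma ext_budget_lipschitz_near:
  fixes Xp :: "'a::real_normed_vector set"
  assumes "conic Xp"
  shows "ext_budget Xp p \<inter> ball x 1
    \<subseteq> ext_budget Xp p' + (\<lambda>b. ((norm x + 1)\<^sup>2 * norm (p - p')) *\<^sub>R b) ` cball 0 1"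
proof
  fix z assume z: "z \<in> ext_budget Xp p \<inter> ball x 1"
  then have "norm z \<le> norm x + 1"
    using norm_triangle_sub[of z x] by (auto simp: dist_norm norm_minus_commute)
  with z show "z \<in> ext_budget Xp p'
      + (\<lambda>b. ((norm x + 1)\<^sup>2 * norm (p - p')) *\<^sub>R b) ` cball 0 1"
    using ext_budget_lipschitz_on_bounded[OF assms] by blast
qed

lemma budget_eq_ext_budget:
  assumes "p \<in> prices Xp"
  shows "budget Xp p = ext_budget Xp p"
  using assms by (simp add: budget_def ext_budget_eq)

theorem theorem3p3:
  fixes Xp :: "'a::banach set"
  assumes "reflexive_space TYPE('a)"
    and "convex_cone Xp" and "closed Xp"
  shows "(\<forall>xs x. x \<in> ext_budget Xp xs - {0} \<and> SNC_at Xp x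
            \<longrightarrow> lipschitz_like_at (ext_budget Xp) (xs, x))
       \<and> (\<forall>p0 x. p0 \<in> prices Xp \<and> x \<in> budget Xp p0 - {0} \<and> SNC_at Xp x
            \<longrightarrow> (\<exists>U V l. open U \<and> p0 \<in> U \<and> open V \<and> x \<in> V \<and> l > 0 \<and>
                  (\<forall>p \<in> U \<inter> prices Xp. \<forall>p' \<in> U \<inter> prices Xp.
                     budget Xp p \<inter> V
                       \<subseteq> budget Xp p' + (\<lambda>b. (l * norm (p - p')) *\<^sub>R b) ` cball 0 1)))"
proof -
  have conic: "conic Xp"
    using assms(2) by (simp add: convex_cone_def)
  have pos: "(norm x + 1)\<^sup>2 > 0" for x :: 'a
    using norm_ge_zero[of x] by (intro zero_less_power) linarith
  have "lipschitz_like_at (ext_budget Xp) (xs, x)" if "x \<in> ext_budget Xp xs" for xs x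
    unfolding lipschitz_like_at_def
  proof (intro conjI exI)
    show "(xs, x) \<in> gph (ext_budget Xp)"
      using that by (simp add: gph_def)
    show "open UNIV" "open (ball x 1)"
      by auto
    show "\<forall>p\<in>UNIV. \<forall>p'\<in>UNIV. ext_budget Xp p \<inter> ball x 1
        \<subseteq> ext_budget Xp p' + (\<lambda>b. ((norm x + 1)\<^sup>2 * norm (p - p')) *\<^sub>R b) ` cball 0 1"
      using ext_budget_lipschitz_near[OF conic] by blast
  qed (use pos in auto)
  moreover have "\<exists>U V l. open U \<and> p0 \<in> U \<and> open V \<and> x \<in> V \<and> l > 0 \<and>
      (\<forall>p \<in> U \<inter> prices Xp. \<forall>p' \<in> U \<inter> prices Xp.
         budget Xp p \<inter> V \<subseteq> budget Xp p' + (\<lambda>b. (l * norm (p - p')) *\<^sub>R b) ` cball 0 1)"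
    for p0 x
  proof (intro exI conjI)
    show "open UNIV" "open (ball x 1)"
      by auto
    show "\<forall>p \<in> UNIV \<inter> prices Xp. \<forall>p' \<in> UNIV \<inter> prices Xp. budget Xp p \<inter> ball x 1
        \<subseteq> budget Xp p' + (\<lambda>b. ((norm x + 1)\<^sup>2 * norm (p - p')) *\<^sub>R b) ` cball 0 1"
      using ext_budget_lipschitz_near[OF conic] by (simp add: budget_eq_ext_budget)
  qed (use pos in auto)
  ultimately show ?thesis
    by blast
qed

end
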